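(* Let $\mathbb{V}$ be a vector space of dimension $n\ge 3$ over the field of $2$ elements, with basis $\{b_1,\dots,b_n\}$, and let $G(\mathbb{V})$ be its non-zero component graph. Then $fxd(G(\mathbb{V}))=2^{n-1}$.
   Context: The non-zero component graph $G(\mathbb{V})$ (with respect to the basis $\{b_1,\dots,b_n\}$) has as vertices the non-zero vectors of $\mathbb{V}$; two distinct vertices are adjacent iff some $b_j$ has non-zero coefficient in both of their expansions in the basis. For a graph $G$, a set $D\subseteq V(G)$ is a fixing set of $G$ if the only automorphism of $G$ that fixes every vertex of $D$ is the identity. The fixed number $fxd(G)$ is the minimum number $k$ such that every subset of $V(G)$ of cardinality $k$ is a fixing set of $G$. *)

theory Defs
  imports "HOL.Vector_Spaces" "Graph_Theory.Pair_Digraph"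
begin

text \<open>
  Simple graphs are records of type \<^typ>\<open>'a pair_pre_digraph\<close>, each edge being stored
  as its two arcs \<open>(u, v)\<close> and \<open>(v, u)\<close>.
\<close>

text \<open>\<open>module.representation scale B v b\<close> is the coefficient of \<open>b\<close> in the expansion of \<open>v\<close> in the basis \<open>B\<close>.\<close>

definition nonzero_component_graph ::
    "('k::field \<Rightarrow> 'v::ab_group_add \<Rightarrow> 'v) \<Rightarrow> 'v set \<Rightarrow> 'v pair_pre_digraph" where
  "nonzero_component_graph scale B =
     \<lparr> pverts = {v. v \<noteq> 0},
       parcs = {(u, v). u \<noteq> 0 \<and> v \<noteq> 0 \<and> u \<noteq> v \<and>
                 (\<exists>b\<in>B. module.representation scale B u b \<noteq> 0 \<and>
                        module.representation scale B v b \<noteq> 0)} \<rparr>"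

lemma pair_loopfree_nonzero_component_graph:
  "pair_loopfree_digraph (nonzero_component_graph scale B)"
  by unfold_locales (auto simp: nonzero_component_graph_def)

lemma sym_nonzero_component_graph: "sym (parcs (nonzero_component_graph scale B))"
  by (auto simp: nonzero_component_graph_def sym_def)

text \<open>Only the values of an automorphism on the vertices matter; elsewhere it is arbitrary.\<close>

definition graph_automorphism :: "'a pair_pre_digraph \<Rightarrow> ('a \<Rightarrow> 'a) \<Rightarrow> bool" where
  "graph_automorphism G f \<longleftrightarrow>
     bij_betw f (pverts G) (pverts G) \<and>
     (\<forall>u\<in>pverts G. \<forall>v\<in>pverts G. (f u, f v) \<in> parcs G \<longleftrightarrow> (u, v) \<in> parcs G)"

definition fixing_set :: "'a pair_pre_digraph \<Rightarrow> 'a set \<Rightarrow> bool" where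
  "fixing_set G D \<longleftrightarrow> D \<subseteq> pverts G \<and>
     (\<forall>f. graph_automorphism G f \<and> (\<forall>v\<in>D. f v = v) \<longrightarrow> (\<forall>v\<in>pverts G. f v = v))"

text \<open>
  Finiteness of \<open>D\<close> is required because \<^const>\<open>card\<close> is \<open>0\<close> on infinite sets. When
  \<open>pverts G\<close> is finite, \<open>k = card (pverts G)\<close> satisfies the condition, so the minimum exists.
\<close>

definition fixed_number :: "'a pair_pre_digraph \<Rightarrow> nat" where
  "fixed_number G =
     (LEAST k. \<forall>D. D \<subseteq> pverts G \<and> finite D \<and> card D = k \<longrightarrow> fixing_set G D)"

end

theory Submission
  imports Defs "HOL-Combinatorics.Transposition"
begin

text \<open>
  Over the two-element field a vector is determined by its support in \<open>B\<close>, so the graph is the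
  intersection graph of the non-empty subsets of \<open>B\<close>. Inclusion of supports means inclusion of
  closed neighbourhoods, hence an automorphism \<open>f\<close> preserves inclusion and permutes the singletons.
  If \<open>f\<close> moves \<open>{a}\<close> to \<open>{c}\<close>, every vertex fixed by \<open>f\<close> contains both or none of \<open>a\<close> and \<open>c\<close>, and
  there are \<open>2 ^ (n - 1) - 1\<close> such vertices; if \<open>f\<close> fixes all singletons, it is the identity.
  The transposition of \<open>a\<close> and \<open>c\<close> shows that the bound is attained.
\<close>

text \<open>Membership of \<open>a\<close> decides membership of \<open>c\<close>, so deleting
  \<open>c\<close> loses no information and leaves an arbitrary subset of \<open>B - {c}\<close>.
  The final \<open>- 1\<close> discards the empty set.\<close>

lemma card_sets_not_separating:
  assumes "finite B" "a \<in> B" "c \<in> B" "a \<noteq> c"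
  shows "card {S \<in> Pow B - {{}}. a \<in> S \<longleftrightarrow> c \<in> S} = 2 ^ (card B - 1) - 1"
proof -
  let ?F = "{S \<in> Pow B. a \<in> S \<longleftrightarrow> c \<in> S}"
  have "bij_betw (\<lambda>S. S - {c}) ?F (Pow (B - {c}))"
    by (rule bij_betw_byWitness[where f' = "\<lambda>T. if a \<in> T then insert c T else T"])
      (use assms in auto)
  then have "card ?F = 2 ^ (card B - 1)"
    using assms by (simp add: bij_betw_same_card card_Pow)
  moreover have "{S \<in> Pow B - {{}}. a \<in> S \<longleftrightarrow> c \<in> S} = ?F - {{}}"
    by blast
  ultimately show ?thesis
    by simp
qed

section \<open>Intersection graphs of the non-empty subsets of a finite set, with vertices named
  through a bijection\<close>

locale subset_intersection_graph =
  fixes G :: "'a pair_pre_digraph" and supp :: "'a \<Rightarrow> 'b set" and B :: "'b set"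
  assumes finite_base: "finite B"
    and supp_bij: "bij_betw supp (pverts G) (Pow B - {{}})"
    and arcs_iff: "\<lbrakk>u \<in> pverts G; v \<in> pverts G\<rbrakk> \<Longrightarrow>
      (u, v) \<in> parcs G \<longleftrightarrow> u \<noteq> v \<and> supp u \<inter> supp v \<noteq> {}"
begin

lemma supp_in: "v \<in> pverts G \<Longrightarrow> supp v \<subseteq> B \<and> supp v \<noteq> {}"
  using supp_bij unfolding bij_betw_def by blast

lemma supp_inject: "\<lbrakk>u \<in> pverts G; v \<in> pverts G\<rbrakk> \<Longrightarrow> supp u = supp v \<longleftrightarrow> u = v"
  using supp_bij unfolding bij_betw_def by (meson inj_on_eq_iff)

lemma supp_surj:
  assumes "S \<subseteq> B" "S \<noteq> {}"
  obtains v where "v \<in> pverts G" "supp v = S"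
proof -
  have "S \<in> supp ` pverts G"
    using assms supp_bij unfolding bij_betw_def by simp
  then show ?thesis using that by blast
qed

text \<open>Expresses inclusion through the relation of meeting alone, which automorphisms preserve.
  Vertices with singleton support serve as tests for membership.\<close>

lemma supp_subset_iff:
  assumes "u \<in> pverts G" "v \<in> pverts G"
  shows "supp u \<subseteq> supp v \<longleftrightarrow>
    (\<forall>w\<in>pverts G. supp w \<inter> supp u \<noteq> {} \<longrightarrow> supp w \<inter> supp v \<noteq> {})"
proof
  assume R: "\<forall>w\<in>pverts G. supp w \<inter> supp u \<noteq> {} \<longrightarrow> supp w \<inter> supp v \<noteq> {}"
  show "supp u \<subseteq> supp v"
  proof
    fix b assume b: "b \<in> supp u"
    then have "{b} \<subseteq> B" using supp_in assms by blast
    then obtain w where "w \<in> pverts G" "supp w = {b}"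
      using supp_surj by blast
    then show "b \<in> supp v" using R b by auto
  qed
qed blast

lemma finite_pverts: "finite (pverts G)"
  using bij_betw_finite[OF supp_bij] finite_base by simp

lemma card_not_separating:
  assumes "a \<in> B" "c \<in> B" "a \<noteq> c"
  shows "card {v \<in> pverts G. a \<in> supp v \<longleftrightarrow> c \<in> supp v} = 2 ^ (card B - 1) - 1"
proof -
  have "supp ` {v \<in> pverts G. a \<in> supp v \<longleftrightarrow> c \<in> supp v} =
      {S \<in> supp ` pverts G. a \<in> S \<longleftrightarrow> c \<in> S}"
    by blast
  also have "\<dots> = {S \<in> Pow B - {{}}. a \<in> S \<longleftrightarrow> c \<in> S}"
    using supp_bij by (simp add: bij_betw_def)
  finally have img: "supp ` {v \<in> pverts G. a \<in> supp v \<longleftrightarrow> c \<in> supp v} =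
      {S \<in> Pow B - {{}}. a \<in> S \<longleftrightarrow> c \<in> S}" .
  have "inj_on supp {v \<in> pverts G. a \<in> supp v \<longleftrightarrow> c \<in> supp v}"
    using supp_bij unfolding bij_betw_def by (rule inj_on_subset[OF conjunct1]) blast
  from card_image[OF this] show ?thesis
    using card_sets_not_separating[OF finite_base assms] by (simp add: img)
qed

section \<open>Action of an automorphism on supports\<close>

context
  fixes f
  assumes f: "graph_automorphism G f"
begin

lemma aut_in: "v \<in> pverts G \<Longrightarrow> f v \<in> pverts G"
  using f unfolding graph_automorphism_def bij_betw_def by blast

lemma aut_inject: "\<lbrakk>u \<in> pverts G; v \<in> pverts G\<rbrakk> \<Longrightarrow> f u = f v \<longleftrightarrow> u = v"
  using f unfolding graph_automorphism_def bij_betw_def by (meson inj_on_eq_iff)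

lemma aut_surj:
  assumes "w \<in> pverts G"
  obtains v where "v \<in> pverts G" "f v = w"
proof -
  have "w \<in> f ` pverts G"
    using assms f unfolding graph_automorphism_def bij_betw_def by simp
  then show ?thesis using that by blast
qed

text \<open>For distinct vertices this is preservation of adjacency. Supports are non-empty, so the
  case \<open>u = v\<close> can be included, which removes the side condition of
  \<open>arcs_iff\<close>.\<close>

lemma aut_meets_iff:
  assumes "u \<in> pverts G" "v \<in> pverts G"
  shows "supp (f u) \<inter> supp (f v) \<noteq> {} \<longleftrightarrow> supp u \<inter> supp v \<noteq> {}"
proof (cases "u = v")
  case True
  then show ?thesis using supp_in aut_in assms by auto
next
  case False
  moreover have "(f u, f v) \<in> parcs G \<longleftrightarrow> (u, v) \<in> parcs G"
    using f assms unfolding graph_automorphism_def by blast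
  ultimately show ?thesis
    using assms by (simp add: arcs_iff aut_in aut_inject)
qed

text \<open>As \<open>f\<close> is onto, the test vertex \<open>w\<close> in
  \<open>supp_subset_iff\<close> may be taken of the form \<open>f w\<close>; then
  \<open>aut_meets_iff\<close> strips \<open>f\<close> everywhere.\<close>

lemma aut_subset_iff:
  assumes "u \<in> pverts G" "v \<in> pverts G"
  shows "supp (f u) \<subseteq> supp (f v) \<longleftrightarrow> supp u \<subseteq> supp v"
proof -
  have "pverts G = f ` pverts G"
    using f unfolding graph_automorphism_def bij_betw_def by simp
  then have "(\<forall>w\<in>pverts G. Q w) \<longleftrightarrow> (\<forall>w\<in>pverts G. Q (f w))" for Q
    by (metis imageE imageI)
  from this[of "\<lambda>w. supp w \<inter> supp (f u) \<noteq> {} \<longrightarrow> supp w \<inter> supp (f v) \<noteq> {}"]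
  show ?thesis
    using assms by (simp add: supp_subset_iff aut_in aut_meets_iff)
qed

text \<open>Singletons are the minimal supports. If \<open>f w\<close> has support
  \<open>{c}\<close> inside \<open>supp (f u)\<close>, then \<open>supp w\<close> lies in
  \<open>{b}\<close>, which forces \<open>w = u\<close>.\<close>

lemma aut_singleton:
  assumes u: "u \<in> pverts G" "supp u = {b}"
  obtains c where "c \<in> B" "supp (f u) = {c}"
proof -
  obtain c where c: "c \<in> supp (f u)" "c \<in> B"
    using supp_in[OF aut_in[OF u(1)]] by blast
  obtain w where w: "w \<in> pverts G" "supp (f w) = {c}"
    using supp_surj[of "{c}"] c(2) aut_surj by (metis empty_subsetI insert_not_empty insert_subset)
  have "supp w \<subseteq> supp u"
    using aut_subset_iff[OF w(1) u(1)] w(2) c(1) by simp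
  then have "supp w = supp u"
    using supp_in[OF w(1)] u(2) by (simp add: subset_singleton_iff)
  then have "w = u"
    using supp_inject u(1) w(1) by blast
  then show ?thesis using that w c by blast
qed

text \<open>Containing \<open>a\<close> means meeting \<open>u\<close>, and \<open>f\<close> carries
  the pair \<open>u\<close>, \<open>v\<close> to \<open>f u\<close>, \<open>v\<close>.\<close>

lemma aut_moved_singleton:
  assumes u: "u \<in> pverts G" "supp u = {a}" "supp (f u) = {c}"
    and v: "v \<in> pverts G" "f v = v"
  shows "a \<in> supp v \<longleftrightarrow> c \<in> supp v"
  using aut_meets_iff[OF u(1) v(1)] u v by auto

text \<open>A support is recovered from the singletons that it meets.\<close>

lemma aut_eq_id:
  assumes fixed: "\<And>u b. \<lbrakk>u \<in> pverts G; supp u = {b}\<rbrakk> \<Longrightarrow> f u = u"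
    and v: "v \<in> pverts G"
  shows "f v = v"
proof -
  have "b \<in> supp (f v) \<longleftrightarrow> b \<in> supp v" if "b \<in> B" for b
  proof -
    obtain u where u: "u \<in> pverts G" "supp u = {b}"
      using supp_surj[of "{b}"] \<open>b \<in> B\<close> by auto
    then show ?thesis
      using aut_meets_iff[OF u(1) v] fixed[OF u] by auto
  qed
  then have "supp (f v) = supp v"
    using supp_in[OF v] supp_in[OF aut_in[OF v]] by blast
  then show ?thesis
    using supp_inject v aut_in by blast
qed

end

section \<open>Fixing sets and the fixed number of the intersection graph\<close>

lemma fixing_set_large:
  assumes D: "D \<subseteq> pverts G" and card: "card D \<ge> 2 ^ (card B - 1)"
  shows "fixing_set G D"
  unfolding fixing_set_def
proof (intro conjI allI impI D)
  fix f assume "graph_automorphism G f \<and> (\<forall>v\<in>D. f v = v)"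
  then have f: "graph_automorphism G f" and fD: "\<And>v. v \<in> D \<Longrightarrow> f v = v"
    by auto
  \<comment> \<open>By \<open>aut_eq_id\<close> it suffices to treat the vertices with singleton
    support.\<close>
  have "f u = u" if u: "u \<in> pverts G" "supp u = {a}" for u a
  proof (rule ccontr)
    assume ne: "f u \<noteq> u"
    obtain c where c: "c \<in> B" "supp (f u) = {c}"
      using aut_singleton[OF f u] .
    have ac: "a \<in> B" "a \<noteq> c"
      using u c ne supp_in[OF u(1)] supp_inject[OF u(1) aut_in[OF f u(1)]] by auto
    have "D \<subseteq> {v \<in> pverts G. a \<in> supp v \<longleftrightarrow> c \<in> supp v}"
      using aut_moved_singleton[OF f u c(2)] fD D by blast
    then have "card D \<le> 2 ^ (card B - 1) - 1"
      using card_mono[of "{v \<in> pverts G. a \<in> supp v \<longleftrightarrow> c \<in> supp v}" D]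
        card_not_separating[OF ac(1) c(1) ac(2)] finite_pverts by simp
    \<comment> \<open>Subtraction on naturals is truncated, so positivity is what makes the bound
      strict.\<close>
    moreover have "(0::nat) < 2 ^ (card B - 1)" by simp
    ultimately show False using card by linarith
  qed
  then show "\<forall>v\<in>pverts G. f v = v"
    using aut_eq_id[OF f] by blast
qed

text \<open>Swapping \<open>a\<close> and \<open>c\<close> in every support preserves meeting and
  fixes each vertex of \<open>D\<close>, but moves the vertex with support
  \<open>{a}\<close>.\<close>

lemma not_fixing_set_not_separating:
  assumes ac: "a \<in> B" "c \<in> B" "a \<noteq> c"
    and D: "D \<subseteq> {v \<in> pverts G. a \<in> supp v \<longleftrightarrow> c \<in> supp v}"
  shows "\<not> fixing_set G D"
proof
  assume fixing: "fixing_set G D"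
  define t where "t S = transpose a c ` S" for S
  define g where "g = the_inv_into (pverts G) supp"
  \<comment> \<open>The action \<open>t\<close> on sets is transported to the vertices, with
    \<open>g\<close> as the inverse of \<open>supp\<close>.\<close>
  define f where "f v = g (t (supp v))" for v
  have t_t: "t (t S) = S" for S
    unfolding t_def by (simp add: image_image)
  have t_B: "t B = B"
    unfolding t_def using ac by (auto simp: transpose_def image_iff)
  have t_in: "t S \<in> Pow B - {{}}" if "S \<in> Pow B - {{}}" for S
  proof -
    have "t S \<subseteq> t B" using that unfolding t_def by blast
    then show ?thesis using that t_B by (auto simp: t_def)
  qed
  have g: "bij_betw g (Pow B - {{}}) (pverts G)"
    unfolding g_def using supp_bij by (rule bij_betw_the_inv_into)
  have t: "bij_betw t (Pow B - {{}}) (Pow B - {{}})"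
    by (rule bij_betw_byWitness[where f' = t]) (use t_in t_t in \<open>simp_all add: image_subset_iff\<close>)
  have "f = g \<circ> (t \<circ> supp)"
    by (simp add: f_def fun_eq_iff)
  then have f_bij: "bij_betw f (pverts G) (pverts G)"
    using bij_betw_trans[OF bij_betw_trans[OF supp_bij t] g] by simp
  then have f_in: "f v \<in> pverts G" if "v \<in> pverts G" for v
    using bij_betwE[OF f_bij] that by blast
  have supp_f: "supp (f v) = t (supp v)" if "v \<in> pverts G" for v
    unfolding f_def g_def
    by (rule f_the_inv_into_f_bij_betw[OF supp_bij]) (use t_in supp_in[OF that] in simp)
  have f_inj: "f u = f v \<longleftrightarrow> u = v" if "u \<in> pverts G" "v \<in> pverts G" for u v
    using that inj_on_eq_iff[OF bij_betw_imp_inj_on[OF f_bij]] by blast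
  have t_Int: "t S \<inter> t T = {} \<longleftrightarrow> S \<inter> T = {}" for S T
    unfolding t_def by (simp add: image_Int[symmetric])
  have aut: "graph_automorphism G f"
    unfolding graph_automorphism_def using f_bij
    by (simp add: arcs_iff f_in f_inj supp_f t_Int)
  have "f v = v" if "v \<in> D" for v
  proof -
    have v: "v \<in> pverts G" "a \<in> supp v \<longleftrightarrow> c \<in> supp v" using that D by auto
    then have "t (supp v) = supp v"
      unfolding t_def by (simp add: transpose_image_eq)
    then show ?thesis
      using v(1) supp_f f_in supp_inject by metis
  qed
  with fixing aut have id: "\<forall>v\<in>pverts G. f v = v"
    unfolding fixing_set_def by blast
  obtain u where u: "u \<in> pverts G" "supp u = {a}"
    using supp_surj[of "{a}"] ac by blast
  have "supp (f u) = {c}"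
    using u supp_f by (simp add: t_def)
  then show False using u id ac by auto
qed

theorem fixed_number_eq:
  assumes "card B \<ge> 2"
  shows "fixed_number G = 2 ^ (card B - 1)"
  unfolding fixed_number_def
proof (rule Least_equality)
  show "\<forall>D. D \<subseteq> pverts G \<and> finite D \<and> card D = 2 ^ (card B - 1) \<longrightarrow> fixing_set G D"
    using fixing_set_large by simp
next
  fix k assume k: "\<forall>D. D \<subseteq> pverts G \<and> finite D \<and> card D = k \<longrightarrow> fixing_set G D"
  obtain T where "T \<subseteq> B" "card T = 2"
    using assms by (rule obtain_subset_with_card_n)
  then obtain a c where ac: "a \<in> B" "c \<in> B" "a \<noteq> c"
    by (auto simp: card_2_iff)
  let ?F = "{v \<in> pverts G. a \<in> supp v \<longleftrightarrow> c \<in> supp v}"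
  show "2 ^ (card B - 1) \<le> k"
  proof (rule ccontr)
    assume "\<not> 2 ^ (card B - 1) \<le> k"
    \<comment> \<open>The condition concerns sets of size exactly \<open>k\<close> and is not known
      to be monotone in \<open>k\<close>, so each smaller \<open>k\<close> gets its own non-fixing
      set, drawn from \<open>?F\<close>.\<close>
    then have "k \<le> card ?F"
      using card_not_separating[OF ac] by simp
    then obtain D where "D \<subseteq> ?F" "card D = k" "finite D"
      by (rule obtain_subset_with_card_n)
    then show False
      using k not_fixing_set_not_separating[OF ac, of D] by blast
  qed
qed

end

section \<open>Supports of vectors over the two-element field\<close>

lemma card_2_field_cases:
  fixes x :: "'k::field"
  assumes "card (UNIV :: 'k set) = 2"
  shows "x = 0 \<or> x = 1"
proof -
  have "finite (UNIV :: 'k set)"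
    using assms by (intro card_ge_0_finite) simp
  then have "{0, 1} = (UNIV :: 'k set)"
    using assms by (intro card_subset_eq) auto
  then show ?thesis by blast
qed

context finite_dimensional_vector_space
begin

text \<open>All coefficients are \<open>0\<close> or \<open>1\<close>, so a vector is the sum of the
  basis vectors in its support; summation is the inverse map.\<close>

lemma bij_betw_support:
  assumes "card (UNIV :: 'a set) = 2"
  shows "bij_betw (\<lambda>v. {b \<in> Basis. representation Basis v b \<noteq> 0}) UNIV (Pow Basis)"
proof (rule bij_betw_byWitness[where f' = "\<lambda>S. \<Sum>b\<in>S. b"])
  note two = card_2_field_cases[OF assms]
  show "\<forall>v\<in>UNIV. \<Sum>{b \<in> Basis. representation Basis v b \<noteq> 0} = v"
  proof
    fix v
    have "v = (\<Sum>b\<in>Basis. representation Basis v b *s b)"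
      using sum_representation_eq[OF independent_Basis _ finite_Basis order_refl, of v]
      by (simp add: span_Basis)
    also have "\<dots> = (\<Sum>b\<in>Basis. if representation Basis v b \<noteq> 0 then b else 0)"
      using two by (intro sum.cong) (auto, metis scale_one)
    also have "\<dots> = \<Sum>{b \<in> Basis. representation Basis v b \<noteq> 0}"
      by (simp add: sum.inter_filter finite_Basis)
    finally show "\<Sum>{b \<in> Basis. representation Basis v b \<noteq> 0} = v" ..
  qed
  show "\<forall>S\<in>Pow Basis. {b \<in> Basis. representation Basis (\<Sum>b\<in>S. b) b \<noteq> 0} = S"
  proof
    fix S assume S: "S \<in> Pow Basis"
    then have "finite S" using finite_Basis finite_subset by blast
    have "representation Basis (\<Sum>b\<in>S. b) b = (if b \<in> S then 1 else 0)" for b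
    proof -
      have "representation Basis (\<Sum>b\<in>S. b) = (\<lambda>b. \<Sum>i\<in>S. representation Basis i b)"
        by (rule representation_sum[OF independent_Basis]) (simp add: span_Basis)
      also have "\<dots> = (\<lambda>b. \<Sum>i\<in>S. if i = b then 1 else 0)"
        using S by (intro ext sum.cong) (auto simp: representation_basis[OF independent_Basis])
      finally show ?thesis using \<open>finite S\<close> by simp
    qed
    then show "{b \<in> Basis. representation Basis (\<Sum>b\<in>S. b) b \<noteq> 0} = S"
      using S by auto
  qed
qed auto

lemma subset_intersection_graph_nonzero_component_graph:
  assumes "card (UNIV :: 'a set) = 2"
  shows "subset_intersection_graph (nonzero_component_graph scale Basis)
    (\<lambda>v. {b \<in> Basis. representation Basis v b \<noteq> 0}) Basis"
proof
  let ?supp = "\<lambda>v. {b \<in> Basis. representation Basis v b \<noteq> 0}"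
  \<comment> \<open>Removing the zero vector on one side removes its support, the empty set, on the
    other.\<close>
  have "bij_betw ?supp (UNIV - {0}) (Pow Basis - {?supp 0})"
    using bij_betw_support[OF assms] by (rule bij_betw_DiffI) auto
  moreover have "?supp 0 = {}"
    by (simp add: representation_zero)
  moreover have "pverts (nonzero_component_graph scale Basis) = UNIV - {0}"
    by (auto simp: nonzero_component_graph_def)
  ultimately show "bij_betw ?supp (pverts (nonzero_component_graph scale Basis)) (Pow Basis - {{}})"
    by (simp only:)
qed (auto simp: nonzero_component_graph_def finite_Basis)

end

theorem theorem4p4:
  fixes scale :: "'k::field \<Rightarrow> 'v::ab_group_add \<Rightarrow> 'v"
    and B :: "'v set"
    and n :: nat
  assumes "card (UNIV :: 'k set) = 2"
    and "finite_dimensional_vector_space scale B"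
    and "vector_space.dim scale (UNIV :: 'v set) = n"
    and "n \<ge> 3"
  shows "fixed_number (nonzero_component_graph scale B) = 2 ^ (n - 1)"
proof -
  interpret finite_dimensional_vector_space scale B by fact
  interpret subset_intersection_graph "nonzero_component_graph scale B"
    "\<lambda>v. {b \<in> B. representation B v b \<noteq> 0}" B
    by (rule subset_intersection_graph_nonzero_component_graph) fact
  have "card B = n"
    using assms(3) by (simp add: dimension_def dim_UNIV)
  then show ?thesis
    using fixed_number_eq assms(4) by simp
qed

end
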